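(* Let $n$ and $k$ be integers with $0\le k<n$. Suppose $X_1,\ldots,X_{n-k}$ are compact subsets of $\mathbb R^n$ and $p\in\mathbb R^n$ is a point that does not belong to $\operatorname{conv}_{k+1} X_i$ for any $i\in\{1,\ldots,n-k\}$. Then there exists an affine $k$-dimensional plane $L\subset\mathbb R^n$ with $p\in L$ such that $L\cap X_i=\emptyset$ for every $i=1,\ldots,n-k$.
   Context: For a compact set $X\subset\mathbb R^n$ and an integer $m\ge 1$, $\operatorname{conv}_{m} X$ denotes the set of points of $\mathbb R^n$ that can be expressed as a convex combination of at most $m$ points of $X$. *)

theory Defs
  imports "HOL-Analysis.Analysis"
begin

definition conv_m :: "nat \<Rightarrow> 'a::real_vector set \<Rightarrow> 'a set" where
  "conv_m m X = {y. \<exists>j u x. 1 \<le> j \<and> j \<le> m \<and> (\<forall>i<j. 0 \<le> u i \<and> x i \<in> X)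
                      \<and> (\<Sum>i<j. u i) = 1 \<and> y = (\<Sum>i<j. u i *\<^sub>R x i)}"

end

theory Submission
  imports Defs "HOL-Library.Z2"
begin

text \<open>Let \<open>p = 0\<close>. For a \<open>k\<close>-plane \<open>L\<close> through \<open>0\<close> with orthonormal basis \<open>f\<^sub>0, \<dots>, f\<^sub>k\<^sub>-\<^sub>1\<close>,
  average the projections to \<open>L\<close> of the points of a fine net of \<open>X i\<close> that are close to \<open>L\<close>.
  If all these \<open>n - k\<close> vectors vanish, then by Caratheodory's theorem in \<open>L\<close> no point of the nets
  is close to \<open>L\<close>, as otherwise \<open>0\<close> would nearly be in \<open>conv_m (k + 1) (X i)\<close>.

  Such an \<open>L\<close> is a common zero of the coordinates of the averages in the \<open>f\<^sub>j\<close> and of the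
  \<open>f\<^sub>i \<bullet> f\<^sub>j\<close>. With \<open>f\<^sub>j\<close> in the unit sphere of dimension \<open>n - k + j\<close>, there are as many of
  these functions as dimensions. Under sign changes of the \<open>f\<^sub>j\<close> they have the parities \<open>t\<^sub>j\<close>
  (\<open>n - k\<close> times) and \<open>t\<^sub>i + t\<^sub>j\<close>, and a zero exists because the coefficient of
  \<open>\<Prod>j. t\<^sub>j\<^bsup>n - k + j\<^esup>\<close> in the product of all parities is odd. This
  Borsuk-Ulam theorem for products of spheres is proved with mod 2 cubical cochains: the cup product
  of the coboundaries of the sign labellings is itself a coboundary, so its sum over a product of
  hemispheres reduces to the boundary, which is made of antipodal pairs.\<close>

section \<open>Cubical cochains modulo 2\<close>

declare add_bit_eq_xor [simp del] mult_bit_eq_and [simp del]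

lemma bit_add_self [simp]: "a + a = (0::bit)"
  by (cases a) simp_all

text \<open>The terms for \<open>(i, j)\<close> and \<open>(j, i)\<close> cancel modulo 2.\<close>

lemma sum_symmetric_bit:
  fixes f :: "'c \<Rightarrow> 'c \<Rightarrow> bit"
  assumes "finite A" and sym: "\<And>i j. i \<in> A \<Longrightarrow> j \<in> A \<Longrightarrow> i \<noteq> j \<Longrightarrow> f i j = f j i"
  shows "(\<Sum>i\<in>A. \<Sum>j\<in>A - {i}. f i j) = 0"
  using assms
proof (induction A rule: finite_induct)
  case (insert a A)
  have "(\<Sum>j\<in>insert a A - {i}. f i j) = f i a + (\<Sum>j\<in>A - {i}. f i j)" if "i \<in> A" for i
  proof -
    have "insert a A - {i} = insert a (A - {i})"
      using insert.hyps that by auto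
    then show ?thesis
      using insert.hyps by simp
  qed
  moreover have "(\<Sum>i\<in>A. f i a) = (\<Sum>j\<in>A. f a j)"
    using insert by (intro sum.cong) auto
  moreover have "insert a A - {a} = A"
    using insert.hyps by auto
  moreover have "(\<Sum>i\<in>A. \<Sum>j\<in>A - {i}. f i j) = 0"
    using insert by auto
  ultimately show ?case
    using insert.hyps by (simp add: sum.distrib)
qed simp

text \<open>The faces of the cubical subdivision of Euclidean space are encoded by integer points:
  an even coordinate \<open>2t\<close> stands for the point \<open>t\<close>, an odd coordinate \<open>2t + 1\<close> for the
  interval between \<open>t\<close> and \<open>t + 1\<close>.\<close>

definition coboundary :: "(('c \<Rightarrow> int) \<Rightarrow> bit) \<Rightarrow> ('c \<Rightarrow> int) \<Rightarrow> bit" where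
  "coboundary \<phi> x = (\<Sum>i | odd (x i). \<phi> (x(i := x i - 1)) + \<phi> (x(i := x i + 1)))"

lemma coboundary_cong:
  assumes "\<And>i v. odd (x i) \<Longrightarrow> even v \<Longrightarrow> \<phi> (x(i := v)) = \<psi> (x(i := v))"
  shows "coboundary \<phi> x = coboundary \<psi> x"
  unfolding coboundary_def by (intro sum.cong refl arg_cong2[of _ _ _ _ "(+)"] assms) auto

lemma coboundary_add: "coboundary (\<lambda>x. \<phi> x + \<psi> x) x = coboundary \<phi> x + coboundary \<psi> x"
  unfolding coboundary_def by (simp flip: sum.distrib) (simp add: ac_simps)

lemma coboundary_cmult: "coboundary (\<lambda>x. c * \<phi> x) x = c * coboundary \<phi> x"
  unfolding coboundary_def by (simp add: sum_distrib_left algebra_simps)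

text \<open>A face of codimension 2 is reached by dropping its two directions in either order, so
  the terms are symmetric and cancel.\<close>

lemma coboundary_coboundary:
  fixes x :: "'c \<Rightarrow> int"
  shows "coboundary (coboundary \<phi>) x = 0"
proof (cases "finite {i. odd (x i)}")
  case True
  define g where "g i j s t = \<phi> (x(i := x i + s, j := x j + t))" for i j s t
  define f where "f i j = (g i j (-1) (-1) + g i j (-1) 1) + (g i j 1 (-1) + g i j 1 1)" for i j
  have *: "coboundary \<phi> (x(i := x i + s)) = (\<Sum>j\<in>{j. odd (x j)} - {i}. g i j s (-1) + g i j s 1)"
    if "odd (x i)" "odd s" for i s
    unfolding coboundary_def g_def using that by (intro sum.cong) auto
  have "coboundary (coboundary \<phi>) x = (\<Sum>i\<in>{i. odd (x i)}. \<Sum>j\<in>{i. odd (x i)} - {i}. f i j)"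
    unfolding coboundary_def[of "coboundary \<phi>"]
    using *[of _ "-1"] *[of _ 1]
    by (intro sum.cong refl) (simp add: f_def sum.distrib)
  also have "\<dots> = 0"
  proof (rule sum_symmetric_bit[OF True])
    fix i j :: 'c assume "i \<noteq> j"
    then have "g i j s t = g j i t s" for s t
      by (simp add: g_def fun_upd_twist)
    then show "f i j = f j i"
      by (simp add: f_def ac_simps)
  qed
  finally show ?thesis .
next
  \<comment> \<open>A sum over infinitely many directions is 0 by convention.\<close>
  case False
  then show ?thesis
    by (simp add: coboundary_def)
qed

text \<open>As \<open>cup l r\<close> is a cocycle, \<open>coboundary (l r * cup l r)\<close> represents its cup product with the
  coboundary of \<open>l r\<close>. Labels are assigned to cells of all dimensions, through their centres.\<close>

primrec cup :: "(nat \<Rightarrow> ('c \<Rightarrow> int) \<Rightarrow> bit) \<Rightarrow> nat \<Rightarrow> ('c \<Rightarrow> int) \<Rightarrow> bit" where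
  "cup l 0 = (\<lambda>x. of_bool (\<forall>i. even (x i)))"
| "cup l (Suc r) = coboundary (\<lambda>x. l r x * cup l r x)"

text \<open>For \<open>r = 0\<close> the two ends of a cell in any direction are both vertices or
  both not; otherwise the cochain is itself a coboundary.\<close>

lemma coboundary_cup: "coboundary (cup l r) x = 0"
proof (cases r)
  case 0
  have "(\<forall>j. even ((x(i := v)) j)) \<longleftrightarrow> (\<forall>j. j \<noteq> i \<longrightarrow> even (x j))" if "even v" for i v
    using that by auto
  then have "coboundary (cup l r) x = (\<Sum>i | odd (x i). 0)"
    unfolding coboundary_def 0 cup.simps by (intro sum.cong refl) simp
  then show ?thesis by simp
next
  case (Suc r')
  then show ?thesis by (simp add: coboundary_coboundary)
qed

section \<open>Invariance under reflections\<close>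

definition reflect :: "'c set \<Rightarrow> int \<Rightarrow> ('c \<Rightarrow> int) \<Rightarrow> 'c \<Rightarrow> int" where
  "reflect R K x = (\<lambda>i. if i \<in> R then K - x i else x i)"

lemma reflect_reflect [simp]: "reflect R K (reflect R K x) = x"
  by (simp add: reflect_def fun_eq_iff)

lemma even_reflect [simp]: "even K \<Longrightarrow> even (reflect R K x i) \<longleftrightarrow> even (x i)"
  by (simp add: reflect_def)

lemma coboundary_reflect:
  assumes "even K"
  shows "coboundary \<phi> (reflect R K x) = coboundary (\<lambda>y. \<phi> (reflect R K y)) x"
  unfolding coboundary_def
proof (intro sum.cong)
  fix i
  let ?r = "reflect R K"
  show "\<phi> ((?r x)(i := ?r x i - 1)) + \<phi> ((?r x)(i := ?r x i + 1))
      = \<phi> (?r (x(i := x i - 1))) + \<phi> (?r (x(i := x i + 1)))"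
  proof (cases "i \<in> R")
    case True
    then have "(?r x)(i := ?r x i - 1) = ?r (x(i := x i + 1))"
      "(?r x)(i := ?r x i + 1) = ?r (x(i := x i - 1))"
      by (auto simp: reflect_def fun_eq_iff)
    then show ?thesis by (simp add: add.commute)
  next
    case False
    then have "(?r x)(i := ?r x i - 1) = ?r (x(i := x i - 1))"
      "(?r x)(i := ?r x i + 1) = ?r (x(i := x i + 1))"
      by (auto simp: reflect_def fun_eq_iff)
    then show ?thesis by simp
  qed
qed (use assms in auto)

text \<open>Shifting a label by a constant changes the next product by that constant times the
  coboundary of a cocycle, which is 0. \<open>Q\<close> describes a region closed under passing to
  facets.\<close>

lemma cup_reflect:
  assumes "even K"
    and Q: "\<And>y i v. Q y \<Longrightarrow> odd (y i) \<Longrightarrow> even v \<Longrightarrow> Q (y(i := v))"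
    and l: "\<And>s y. s < r \<Longrightarrow> Q y \<Longrightarrow> l s (reflect R K y) = l s y + c s"
    and "Q x"
  shows "cup l r (reflect R K x) = cup l r x"
  using l \<open>Q x\<close>
proof (induction r arbitrary: x)
  case 0
  then show ?case using \<open>even K\<close> by simp
next
  case (Suc r)
  have "cup l (Suc r) (reflect R K x)
      = coboundary (\<lambda>y. l r (reflect R K y) * cup l r (reflect R K y)) x"
    by (simp add: coboundary_reflect[OF \<open>even K\<close>])
  also have "\<dots> = coboundary (\<lambda>y. l r y * cup l r y + c r * cup l r y) x"
  proof (rule coboundary_cong)
    fix i and v :: int assume "odd (x i)" "even v"
    then have "Q (x(i := v))"
      using Q Suc.prems by blast
    then show "l r (reflect R K (x(i := v))) * cup l r (reflect R K (x(i := v)))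
      = l r (x(i := v)) * cup l r (x(i := v)) + c r * cup l r (x(i := v))"
      using Suc.prems(1)[of r "x(i := v)"] Suc.IH[OF Suc.prems(1), of "x(i := v)"]
      by (simp add: distrib_right del: fun_upd_apply)
  qed
  also have "\<dots> = cup l (Suc r) x"
    by (simp add: coboundary_add coboundary_cmult coboundary_cup)
  finally show ?case .
qed

text \<open>In the induction for the second part, the first part cancels the two ends of a cell in
  direction \<open>j\<close>.\<close>

lemma cup_degenerate:
  assumes Q: "\<And>y i v. Q y \<Longrightarrow> odd (y i) \<Longrightarrow> even v \<Longrightarrow> Q (y(i := v))"
    and Qj: "\<And>y v. Q y \<Longrightarrow> Q (y(j := v))"
    and l: "\<And>s y v. s < r \<Longrightarrow> Q y \<Longrightarrow> l s (y(j := v)) = l s y"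
    and "Q x"
  shows "even (x j) \<Longrightarrow> even v \<Longrightarrow> cup l r (x(j := v)) = cup l r x"
    and "odd (x j) \<Longrightarrow> cup l r x = 0"
  using l \<open>Q x\<close>
proof (induction r arbitrary: x v)
  case 0
  {
    case 1
    then show ?case by (auto simp: fun_upd_def)
  next
    case 2
    then show ?case by auto
  }
next
  case (Suc r)
  {
    case 1
    have "l r (x(j := v, i := w)) * cup l r (x(j := v, i := w)) =
        l r (x(i := w)) * cup l r (x(i := w))" if "odd (x i)" "even w" for i w
    proof -
      from that 1 have "i \<noteq> j" by auto
      then have "x(j := v, i := w) = x(i := w, j := v)"
        by (simp add: fun_upd_twist)
      moreover have "Q (x(i := w))"
        using that Q 1 by blast
      ultimately show ?thesis
        using Suc.IH(1)[of "x(i := w)" v] 1(3)[of r "x(i := w)" v] 1 \<open>i \<noteq> j\<close>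
        by (simp del: fun_upd_apply add: fun_upd_other)
    qed
    moreover have "{i. odd ((x(j := v)) i)} = {i. odd (x i)}"
      using 1 by auto
    moreover have "i \<noteq> j" if "odd (x i)" for i
      using that 1 by auto
    ultimately show ?case
      unfolding cup.simps coboundary_def by (intro sum.cong) auto
  next
    case 2
    have "l r (x(i := x i - 1)) * cup l r (x(i := x i - 1))
        + l r (x(i := x i + 1)) * cup l r (x(i := x i + 1)) = 0" if "odd (x i)" for i
    proof (cases "i = j")
      case True
      have "Q (x(j := x j - 1))"
        using 2 Qj by blast
      then have "cup l r (x(j := x j - 1, j := x j + 1)) = cup l r (x(j := x j - 1))"
        using Suc.IH(1)[of "x(j := x j - 1)" "x j + 1"] 2
        by (simp del: fun_upd_apply add: fun_upd_same)
      moreover have "l r (x(j := x j + 1)) = l r (x(j := x j - 1))"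
        using 2(2)[of r x] 2(3) by (simp del: fun_upd_apply)
      ultimately show ?thesis
        using True by simp
    next
      case False
      have "cup l r (x(i := w)) = 0" if "even w" for w
        using Suc.IH(2)[of "x(i := w)"] 2 False Q[of x i w] \<open>odd (x i)\<close> that
        by (simp del: fun_upd_apply add: fun_upd_other)
      then show ?thesis
        using that by simp
    qed
    then show ?case
      unfolding cup.simps coboundary_def by (intro sum.neutral) auto
  }
qed

section \<open>Faces of cells and changes of labels\<close>

definition face_of_cell :: "('c \<Rightarrow> int) \<Rightarrow> ('c \<Rightarrow> int) \<Rightarrow> bool" where
  "face_of_cell y x \<longleftrightarrow> (\<forall>i. y i = x i \<or> odd (x i) \<and> even (y i) \<and> \<bar>y i - x i\<bar> = 1)"

lemma face_of_cell_facet: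
  assumes "face_of_cell y (x(i := x i + d))" "odd (x i)" "\<bar>d\<bar> = 1"
  shows "face_of_cell y x"
  unfolding face_of_cell_def
proof
  fix j
  show "y j = x j \<or> odd (x j) \<and> even (y j) \<and> \<bar>y j - x j\<bar> = 1"
    using assms(1)[unfolded face_of_cell_def, rule_format, of j] assms(2,3)
    by (cases "j = i") (auto simp: abs_if split: if_splits)
qed

text \<open>A label constant on the faces could be pulled out of its coboundary, leaving the
  coboundary of a cocycle. A later product is non-zero only if the previous one is non-zero on some
  facet.\<close>

lemma cup_nonzero_label_change:
  assumes "cup l r x \<noteq> 0" "s < r"
  shows "\<exists>y z. face_of_cell y x \<and> face_of_cell z x \<and> l s y = 0 \<and> l s z = 1"
  using assms
proof (induction r arbitrary: x)
  case (Suc r)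
  have facet: "face_of_cell (x(i := x i + d)) x" if "odd (x i)" "\<bar>d\<bar> = 1" for i d
    using that by (auto simp: face_of_cell_def)
  show ?case
  proof (cases "s = r")
    case True
    show ?thesis
    proof (rule ccontr)
      assume neg: "\<not> ?thesis"
      have "\<exists>c. \<forall>y. face_of_cell y x \<longrightarrow> l r y = c"
        using neg True by (metis bit_not_zero_iff)
      then obtain c where c: "\<And>y. face_of_cell y x \<Longrightarrow> l r y = c"
        by blast
      have "cup l (Suc r) x = coboundary (\<lambda>y. c * cup l r y) x"
        unfolding cup.simps coboundary_def
        using c[OF facet[of _ "-1"]] c[OF facet[of _ 1]] by (intro sum.cong) auto
      then show False
        using Suc.prems by (simp add: coboundary_cmult coboundary_cup)
    qed
  next
    case False
    have "\<exists>i d. odd (x i) \<and> \<bar>d\<bar> = 1 \<and> cup l r (x(i := x i + d)) \<noteq> 0"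
    proof (rule ccontr)
      assume "\<not> ?thesis"
      then have "cup l r (x(i := x i + 1)) = 0 \<and> cup l r (x(i := x i + (-1))) = 0"
        if "odd (x i)" for i
        using that by (metis abs_minus abs_one)
      then have "cup l (Suc r) x = 0"
        unfolding cup.simps coboundary_def by (intro sum.neutral) auto
      then show False
        using Suc.prems by simp
    qed
    then obtain i d where "odd (x i)" "\<bar>d\<bar> = 1" "cup l r (x(i := x i + d)) \<noteq> 0"
      by blast
    then show ?thesis
      using Suc.IH[of "x(i := x i + d)"] False Suc.prems face_of_cell_facet by (metis less_SucE)
  qed
qed simp

section \<open>Sums over the cells of a cube\<close>

definition box_cells :: "nat \<Rightarrow> 'c set \<Rightarrow> ('c \<Rightarrow> int) set" where
  "box_cells M I = {x. (\<forall>i\<in>I. odd (x i) \<and> 0 < x i \<and> x i < 2 * int M) \<and> (\<forall>i. i \<notin> I \<longrightarrow> x i = 0)}"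

lemma box_cells_insert:
  assumes "i \<notin> I"
  shows "bij_betw (\<lambda>(y, t). y(i := 2 * int t + 1)) (box_cells M I \<times> {..<M}) (box_cells M (insert i I))"
proof (rule bij_betwI[where g = "\<lambda>x. (x(i := 0), nat (x i div 2))"], goal_cases)
  case 1
  then show ?case using assms by (auto simp: box_cells_def split: if_splits)
next
  case 2
  then show ?case using assms by (auto simp: box_cells_def split: if_splits)
next
  case (3 x)
  then show ?case using assms by (auto simp: box_cells_def fun_eq_iff)
next
  case (4 x)
  then show ?case using assms by (auto simp: box_cells_def fun_eq_iff elim!: oddE)
qed

text \<open>Discrete Stokes formula: inner walls are shared by two neighbouring cells and
  cancel.\<close>

lemma sum_coboundary_box:
  fixes \<phi> :: "('c \<Rightarrow> int) \<Rightarrow> bit"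
  assumes "finite I"
  shows "(\<Sum>x\<in>box_cells M I. coboundary \<phi> x)
    = (\<Sum>i\<in>I. \<Sum>y\<in>box_cells M (I - {i}). \<phi> y + \<phi> (y(i := 2 * int M)))"
proof -
  have tele: "(\<Sum>t<m. g t + g (Suc t)) = g 0 + g m" for g :: "nat \<Rightarrow> bit" and m
    by (induction m) (auto simp: ac_simps)
  have "(\<Sum>x\<in>box_cells M I. coboundary \<phi> x)
      = (\<Sum>x\<in>box_cells M I. \<Sum>i\<in>I. \<phi> (x(i := x i - 1)) + \<phi> (x(i := x i + 1)))"
  proof (intro sum.cong refl)
    fix x assume "x \<in> box_cells M I"
    then have "{i. odd (x i)} = I"
      by (fastforce simp: box_cells_def)
    then show "coboundary \<phi> x = (\<Sum>i\<in>I. \<phi> (x(i := x i - 1)) + \<phi> (x(i := x i + 1)))"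
      by (simp add: coboundary_def)
  qed
  also have "\<dots> = (\<Sum>i\<in>I. \<Sum>x\<in>box_cells M I. \<phi> (x(i := x i - 1)) + \<phi> (x(i := x i + 1)))"
    by (rule sum.swap)
  also have "\<dots> = (\<Sum>i\<in>I. \<Sum>y\<in>box_cells M (I - {i}). \<phi> y + \<phi> (y(i := 2 * int M)))"
  proof (rule sum.cong[OF refl])
    fix i assume "i \<in> I"
    then have "bij_betw (\<lambda>(y, t). y(i := 2 * int t + 1)) (box_cells M (I - {i}) \<times> {..<M}) (box_cells M I)"
      using box_cells_insert[of i "I - {i}" M] by (simp add: insert_absorb)
    then have "(\<Sum>x\<in>box_cells M I. \<phi> (x(i := x i - 1)) + \<phi> (x(i := x i + 1)))
      = (\<Sum>(y, t)\<in>box_cells M (I - {i}) \<times> {..<M}. \<phi> (y(i := 2 * int t)) + \<phi> (y(i := 2 * int (Suc t))))"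
      by (subst sum.reindex_bij_betw[symmetric]) (auto intro!: sum.cong simp: add.commute)
    also have "\<dots> = (\<Sum>y\<in>box_cells M (I - {i}). \<Sum>t<M. \<phi> (y(i := 2 * int t)) + \<phi> (y(i := 2 * int (Suc t))))"
      by (simp add: sum.cartesian_product)
    also have "\<dots> = (\<Sum>y\<in>box_cells M (I - {i}). \<phi> (y(i := 0)) + \<phi> (y(i := 2 * int M)))"
      by (subst tele) simp
    also have "\<dots> = (\<Sum>y\<in>box_cells M (I - {i}). \<phi> y + \<phi> (y(i := 2 * int M)))"
    proof (intro sum.cong refl)
      fix y assume "y \<in> box_cells M (I - {i})"
      then have "y(i := 0) = y" by (auto simp: box_cells_def)
      then show "\<phi> (y(i := 0)) + \<phi> (y(i := 2 * int M)) = \<phi> y + \<phi> (y(i := 2 * int M))" by simp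
    qed
    finally show "(\<Sum>x\<in>box_cells M I. \<phi> (x(i := x i - 1)) + \<phi> (x(i := x i + 1)))
      = (\<Sum>y\<in>box_cells M (I - {i}). \<phi> y + \<phi> (y(i := 2 * int M)))" .
  qed
  finally show ?thesis .
qed

section \<open>Cup products on products of hemispheres\<close>

text \<open>Block \<open>b\<close> of coordinates holds the spherical coordinates of a point on a sphere, the
  range \<open>{0..2 * M}\<close> standing for \<open>{0..pi}\<close>. The coordinate \<open>(b, j)\<close> is irrelevant if an earlier
  angle of the block is \<open>0\<close> or \<open>pi\<close>. Points whose last coordinate is \<open>0\<close> are the boundary of
  the hemisphere, on which the antipodal map flips all the earlier angles.\<close>

locale antipodal_labelling =
  fixes l :: "nat \<Rightarrow> (nat \<times> nat \<Rightarrow> int) \<Rightarrow> bit" and J :: "nat \<Rightarrow> nat set" and k N M :: nat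
  assumes degenerate: "\<And>r b i j x v. r < N \<Longrightarrow> i < j \<Longrightarrow> x (b, i) \<in> {0, 2 * int M} \<Longrightarrow>
      l r (x((b, j) := v)) = l r x"
    and antipodal: "\<And>r b i x. r < N \<Longrightarrow> b < k \<Longrightarrow> (\<And>j. i \<le> j \<Longrightarrow> x (b, j) = 0) \<Longrightarrow>
      l r (reflect ({b} \<times> {..i}) (2 * int M) x) = l r x + of_bool (b \<in> J r)"
    and J: "\<And>r. r < N \<Longrightarrow> J r \<noteq> {} \<and> J r \<subseteq> {..<k}"
begin

definition hemi_cells :: "(nat \<Rightarrow> nat) \<Rightarrow> (nat \<times> nat \<Rightarrow> int) set" where
  "hemi_cells a = box_cells M (SIGMA b:{..<k}. {..<a b})"

definition cup_number :: "nat \<Rightarrow> (nat \<Rightarrow> nat) \<Rightarrow> bit" where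
  "cup_number r a = (\<Sum>x\<in>hemi_cells a. cup l r x)"

text \<open>The labels do not see coordinate \<open>(b, j)\<close>, although the cell extends in
  that direction. Since \<open>x (b, i)\<close> is even, all faces share it.\<close>

lemma cup_eq_0_if_degenerate:
  assumes "r < N" "i < j" "x (b, i) \<in> {0, 2 * int M}" "odd (x (b, j))"
  shows "cup l r x = 0"
proof (rule cup_degenerate(2)[where Q = "\<lambda>y. y (b, i) = x (b, i)" and j = "(b, j)"])
  show "l s (y((b, j) := v)) = l s y" if "s < r" "y (b, i) = x (b, i)" for s y v
    using that assms by (intro degenerate[of s i j]) auto
qed (use assms in auto)

text \<open>The recursion for the coefficient of \<open>\<Prod>b. t b ^ a b\<close> in a product of
  linear forms. Stokes reduces the sum to the walls, and only those of the last angle of each block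
  contribute.\<close>

lemma cup_number_Suc:
  assumes "r < N"
  shows "cup_number (Suc r) a
    = (\<Sum>b | b < k \<and> 0 < a b \<and> b \<in> J r. cup_number r (a(b := a b - 1)))"
proof -
  define K where "K = 2 * int M"
  define \<phi> where "\<phi> x = l r x * cup l r x" for x
  define I where "I = (SIGMA b:{..<k}. {..<a b})"
  define T where "T b i = (\<Sum>y\<in>box_cells M (I - {(b, i)}). \<phi> y + \<phi> (y((b, i) := K)))" for b i
  \<comment> \<open>On the walls of an earlier angle the last angle is irrelevant, yet the cells
    extend in its direction.\<close>
  have T0: "T b i = 0" if "b < k" "i < a b - 1" for b i
    unfolding T_def
  proof (intro sum.neutral ballI)
    fix y assume "y \<in> box_cells M (I - {(b, i)})"
    then have "y (b, i) = 0" "odd (y (b, a b - 1))"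
      using that by (auto simp: box_cells_def I_def)
    then have "cup l r y = 0" "cup l r (y((b, i) := K)) = 0"
      using that assms
      by (auto intro!: cup_eq_0_if_degenerate[of r i "a b - 1" _ b] simp: K_def)
    then show "\<phi> y + \<phi> (y((b, i) := K)) = 0"
      by (simp add: \<phi>_def)
  qed
  \<comment> \<open>The antipodal map exchanges the two walls of the last angle. It preserves
    \<open>cup l r\<close> and shifts \<open>l r\<close> by \<open>of_bool (b \<in> J r)\<close>, so
    only the shift survives in the sum.\<close>
  have T1: "T b i = of_bool (b \<in> J r) * cup_number r (a(b := a b - 1))"
    if "b < k" "0 < a b" "i = a b - 1" for b i
  proof -
    let ?R = "reflect ({b} \<times> {..<i}) K" and ?R' = "reflect ({b} \<times> {..i}) K"
    let ?B = "hemi_cells (a(b := a b - 1))"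
    have "I - {(b, i)} = (SIGMA b':{..<k}. {..<(a(b := a b - 1)) b'})"
      using that by (auto simp: I_def split: if_splits)
    then have B: "box_cells M (I - {(b, i)}) = ?B"
      by (simp add: hemi_cells_def)
    have zero: "y (b, j) = 0" if "y \<in> ?B" "i \<le> j" for y j
      using that \<open>i = a b - 1\<close> by (auto simp: hemi_cells_def box_cells_def)
    have "?R y \<in> ?B" if "y \<in> ?B" for y
      using that \<open>b < k\<close> \<open>i = a b - 1\<close> unfolding hemi_cells_def box_cells_def
      by (auto simp: reflect_def K_def)
    then have bij: "bij_betw ?R ?B ?B"
      by (intro bij_betwI[where g = ?R]) auto
    have upd: "(?R y)((b, i) := K) = ?R' y" if "y \<in> ?B" for y
      using zero[OF that, of i] by (auto simp: reflect_def fun_eq_iff)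
    have l_refl: "l s (?R' y) = l s y + of_bool (b \<in> J s)"
      if "s \<le> r" "\<forall>j\<ge>i. y (b, j) = 0" for s y
      using that assms \<open>b < k\<close> unfolding K_def by (intro antipodal) auto
    have cup_refl: "cup l r (?R' y) = cup l r y" if "y \<in> ?B" for y
    proof (rule cup_reflect[where Q = "\<lambda>y. \<forall>j\<ge>i. y (b, j) = 0"])
      show "\<forall>j\<ge>i. y (b, j) = 0"
        using zero that by auto
      show "l s (?R' y) = l s y + of_bool (b \<in> J s)" if "s < r" "\<forall>j\<ge>i. y (b, j) = 0" for s y
        using that by (intro l_refl) auto
    qed (auto simp: K_def)
    have "(\<Sum>y\<in>?B. \<phi> (y((b, i) := K))) = (\<Sum>y\<in>?B. \<phi> (?R' y))"
      by (subst sum.reindex_bij_betw[OF bij, symmetric]) (simp add: upd cong: sum.cong)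
    also have "\<dots> = (\<Sum>y\<in>?B. \<phi> y + of_bool (b \<in> J r) * cup l r y)"
      using zero by (intro sum.cong) (auto simp: \<phi>_def cup_refl l_refl distrib_right)
    finally show ?thesis
      by (simp add: T_def B sum.distrib cup_number_def sum_distrib_left)
  qed
  have "cup_number (Suc r) a = (\<Sum>x\<in>box_cells M I. coboundary \<phi> x)"
    by (simp add: cup_number_def hemi_cells_def I_def \<phi>_def[abs_def])
  also have "\<dots> = (\<Sum>(b, i)\<in>I. T b i)"
    by (subst sum_coboundary_box) (auto simp: I_def T_def K_def intro!: sum.cong)
  also have "\<dots> = (\<Sum>b<k. \<Sum>i<a b. T b i)"
    by (simp add: I_def sum.Sigma)
  also have "\<dots> = (\<Sum>b<k. if 0 < a b \<and> b \<in> J r then cup_number r (a(b := a b - 1)) else 0)"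
  proof (intro sum.cong refl)
    fix b assume "b \<in> {..<k}"
    show "(\<Sum>i<a b. T b i) = (if 0 < a b \<and> b \<in> J r then cup_number r (a(b := a b - 1)) else 0)"
    proof (cases "a b")
      case (Suc d)
      have "(\<Sum>i<d. T b i) = 0"
        using T0 Suc \<open>b \<in> {..<k}\<close> by (intro sum.neutral) auto
      moreover have "T b d = of_bool (b \<in> J r) * cup_number r (a(b := a b - 1))"
        by (rule T1) (use Suc \<open>b \<in> {..<k}\<close> in simp_all)
      moreover have "(\<Sum>i<a b. T b i) = (\<Sum>i<d. T b i) + T b d"
        unfolding Suc by simp
      ultimately show ?thesis
        using Suc by (simp only: of_bool_def) simp
    qed simp
  qed
  also have "\<dots> = (\<Sum>b | b < k \<and> 0 < a b \<and> b \<in> J r. cup_number r (a(b := a b - 1)))"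
  proof -
    have "{b. b < k \<and> 0 < a b \<and> b \<in> J r} = {b \<in> {..<k}. 0 < a b \<and> b \<in> J r}"
      by auto
    then show ?thesis
      by (simp only: sum.inter_filter[OF finite_lessThan])
  qed
  finally show ?thesis .
qed

section \<open>The leading monomial of the product of the parities\<close>

definition leader :: "nat \<Rightarrow> nat" where
  "leader r = Max (J r)"

text \<open>Exponents of the product of the leading variables of the first \<open>r\<close> forms
  \<open>\<Sum>b\<in>J s. t b\<close>.\<close>

definition leader_count :: "nat \<Rightarrow> nat \<Rightarrow> nat" where
  "leader_count r b = card {s. s < r \<and> leader s = b}"

lemma leader:
  assumes "r < N"
  shows "leader r \<in> J r" "leader r < k" "\<And>b. b \<in> J r \<Longrightarrow> b \<le> leader r"
proof -
  have "finite (J r)"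
    using J[OF assms] finite_subset by blast
  then show "leader r \<in> J r" "leader r < k" "\<And>b. b \<in> J r \<Longrightarrow> b \<le> leader r"
    using J[OF assms] Max_in[of "J r"] Max_ge[of "J r"] by (auto simp: leader_def)
qed

lemma leader_count_Suc:
  "leader_count (Suc r) = (leader_count r)(leader r := Suc (leader_count r (leader r)))"
proof
  fix b
  have "{s. s < Suc r \<and> leader s = b}
      = (if b = leader r then insert r {s. s < r \<and> leader s = b} else {s. s < r \<and> leader s = b})"
    by (auto simp: less_Suc_eq)
  then show "leader_count (Suc r) b = ((leader_count r)(leader r := Suc (leader_count r (leader r)))) b"
    by (simp add: leader_count_def)
qed

lemma sum_fun_upd:
  fixes f :: "'c \<Rightarrow> nat"
  assumes "finite A" "c \<in> A"
  shows "sum (f(c := v)) A + f c = sum f A + v"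
proof -
  have "sum (f(c := v)) (A - {c}) = sum f (A - {c})"
    by (intro sum.cong) auto
  then show ?thesis
    using sum.remove[OF assms, of f] sum.remove[OF assms, of "f(c := v)"] by simp
qed

text \<open>A factor can contribute a variable of index at least \<open>j\<close> only if its leader
  has such an index, so no monomial exceeds the leading one in its degree in these
  variables.\<close>

lemma cup_number_eq_0:
  assumes "r \<le> N" "sum (leader_count r) {j..<k} < sum a {j..<k}"
  shows "cup_number r a = 0"
  using assms
proof (induction r arbitrary: a)
  case 0
  then obtain b where "b < k" "0 < a b"
    by (metis atLeastLessThan_iff gr_zeroI less_nat_zero_code sum.neutral)
  then have "odd (x (b, 0))" if "x \<in> hemi_cells a" for x
    using that by (auto simp: hemi_cells_def box_cells_def)
  then show ?case
    unfolding cup_number_def cup.simps by (intro sum.neutral) auto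
next
  case (Suc r)
  have "cup_number r (a(b := a b - 1)) = 0" if "b < k" "0 < a b" "b \<in> J r" for b
  proof (rule Suc.IH)
    have "leader r < k" "b \<le> leader r"
      using leader[of r] Suc.prems that by auto
    moreover have "sum (a(b := a b - 1)) {j..<k} = sum a {j..<k}" if "b < j"
      using that by (intro sum.cong) auto
    moreover have "sum (leader_count r) {j..<k} \<le> sum (leader_count (Suc r)) {j..<k}"
      by (intro sum_mono) (simp add: leader_count_Suc)
    \<comment> \<open>From \<open>Suc r\<close> to \<open>r\<close>, both sums drop by 1 if
      \<open>j \<le> b\<close>, since \<open>b \<le> leader r\<close>; otherwise the right one is
      unchanged and the left one does not grow.\<close>
    ultimately show "sum (leader_count r) {j..<k} < sum (a(b := a b - 1)) {j..<k}"
      using Suc.prems(2) that sum_fun_upd[of "{j..<k}" b a "a b - 1"]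
        sum_fun_upd[of "{j..<k}" "leader r" "leader_count r" "Suc (leader_count r (leader r))"]
      unfolding leader_count_Suc by (cases "j \<le> b") auto
  qed (use Suc.prems in auto)
  then show ?case
    using Suc.prems by (subst cup_number_Suc) (auto intro!: sum.neutral)
qed

lemma cup_number_leader_count: "r \<le> N \<Longrightarrow> cup_number r (leader_count r) = 1"
proof (induction r)
  case 0
  have "hemi_cells (leader_count 0) = {\<lambda>_. 0}"
    by (auto simp: hemi_cells_def box_cells_def leader_count_def)
  then show ?case
    by (simp add: cup_number_def)
next
  case (Suc r)
  let ?a = "leader_count (Suc r)"
  define B where "B = {b. b < k \<and> 0 < ?a b \<and> b \<in> J r}"
  have "r < N" using Suc.prems by simp
  then have "leader r \<in> B" "finite B"
    using leader(1,2)[of r] by (auto simp: B_def leader_count_Suc)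
  \<comment> \<open>Taking a variable below the leader leaves the first \<open>r\<close> factors too
    large a degree above index \<open>b\<close>.\<close>
  have "cup_number r (?a(b := ?a b - 1)) = 0" if "b \<in> B - {leader r}" for b
  proof (rule cup_number_eq_0)
    have b: "b < leader r" "leader r < k"
      using leader(2,3)[OF \<open>r < N\<close>] that by (auto simp: B_def intro: le_neq_implies_less)
    show "sum (leader_count r) {Suc b..<k} < sum (?a(b := ?a b - 1)) {Suc b..<k}"
    proof (rule sum_strict_mono_ex1)
      show "\<forall>i\<in>{Suc b..<k}. leader_count r i \<le> (?a(b := ?a b - 1)) i"
        by (simp add: leader_count_Suc)
      show "\<exists>i\<in>{Suc b..<k}. leader_count r i < (?a(b := ?a b - 1)) i"
        using b by (intro bexI[of _ "leader r"]) (simp_all add: leader_count_Suc)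
    qed simp
  qed (use Suc.prems in auto)
  then have "(\<Sum>b\<in>B - {leader r}. cup_number r (?a(b := ?a b - 1))) = 0"
    by (intro sum.neutral) auto
  moreover have "?a(leader r := ?a (leader r) - 1) = leader_count r"
    by (simp add: leader_count_Suc)
  ultimately have "(\<Sum>b\<in>B. cup_number r (?a(b := ?a b - 1))) = 1"
    using Suc.IH Suc.prems by (simp add: sum.remove[OF \<open>finite B\<close> \<open>leader r \<in> B\<close>])
  then show ?case
    using \<open>r < N\<close> by (simp add: cup_number_Suc B_def)
qed

text \<open>Combinatorial Borsuk-Ulam theorem: an odd cup number forces a cell with non-zero cup
  product.\<close>

lemma ex_cell_all_labels_change:
  "\<exists>x\<in>hemi_cells (leader_count N). \<forall>r<N. \<exists>y z. face_of_cell y x \<and> face_of_cell z x \<and> l r y = 0 \<and> l r z = 1"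
proof -
  have "cup_number N (leader_count N) \<noteq> 0"
    by (simp add: cup_number_leader_count)
  then obtain x where "x \<in> hemi_cells (leader_count N)" "cup l N x \<noteq> 0"
    unfolding cup_number_def by (meson sum.neutral)
  then show ?thesis
    using cup_nonzero_label_change by blast
qed

end

section \<open>Common zeros of functions on products of spheres\<close>

text \<open>Cartesian coordinates of an infinite list of angles; \<open>\<theta> d = 0\<close> cuts
  them off after index \<open>d\<close>, giving a point of the \<open>d\<close>-sphere.\<close>

definition spherical :: "(nat \<Rightarrow> real) \<Rightarrow> nat \<Rightarrow> real" where
  "spherical \<theta> n = cos (\<theta> n) * (\<Prod>i<n. sin (\<theta> i))"

lemma spherical_fun_upd:
  assumes "sin (\<theta> i) = 0" "i < j"
  shows "spherical (\<theta>(j := v)) = spherical \<theta>"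
proof
  fix n
  show "spherical (\<theta>(j := v)) n = spherical \<theta> n"
  proof (cases "n < j")
    case True
    then show ?thesis
      unfolding spherical_def by (auto intro!: arg_cong2[of _ _ _ _ "(*)"] prod.cong)
  next
    case False
    then have "(\<Prod>i<n. sin ((\<theta>(j := v)) i)) = 0" "(\<Prod>i<n. sin (\<theta> i)) = 0"
      using assms by (auto intro!: prod_zero bexI[of _ i])
    then show ?thesis
      by (simp only: spherical_def mult_zero_right)
  qed
qed

text \<open>Up to index \<open>i\<close> only the cosine changes sign; later coordinates contain the
  factor \<open>sin (\<theta> i) = 0\<close>.\<close>

lemma spherical_antipode:
  assumes "\<theta> i = 0"
  shows "spherical (\<lambda>j. if j \<le> i then pi - \<theta> j else \<theta> j) n = - spherical \<theta> n"
proof (cases "n \<le> i")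
  case True
  then show ?thesis
    unfolding spherical_def by (auto intro!: arg_cong2[of _ _ _ _ "(*)"] prod.cong)
next
  case False
  then have "(\<Prod>j<n. sin (if j \<le> i then pi - \<theta> j else \<theta> j)) = 0" "(\<Prod>j<n. sin (\<theta> j)) = 0"
    using assms by (auto intro!: prod_zero bexI[of _ i])
  then show ?thesis
    by (simp only: spherical_def mult_zero_right minus_zero)
qed

lemma spherical_eq_0: "\<theta> d = 0 \<Longrightarrow> d < n \<Longrightarrow> spherical \<theta> n = 0"
  unfolding spherical_def by (auto intro!: prod_zero bexI[of _ d])

lemma sum_spherical_squares:
  assumes "\<theta> d = 0"
  shows "(\<Sum>n\<le>d. (spherical \<theta> n)\<^sup>2) = 1"
proof -
  \<comment> \<open>The product of the first \<open>m\<close> sines is the length left over after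
    \<open>m\<close> coordinates; it vanishes once an angle is 0.\<close>
  have "(\<Sum>n<m. (spherical \<theta> n)\<^sup>2) + (\<Prod>i<m. sin (\<theta> i))\<^sup>2 = 1" for m
  proof (induction m)
    case (Suc m)
    define P where "P = (\<Prod>i<m. sin (\<theta> i))"
    have "(spherical \<theta> m)\<^sup>2 + (\<Prod>i<Suc m. sin (\<theta> i))\<^sup>2
        = ((cos (\<theta> m))\<^sup>2 + (sin (\<theta> m))\<^sup>2) * P\<^sup>2"
      unfolding spherical_def prod.lessThan_Suc P_def[symmetric] by algebra
    then show ?case
      using Suc by (simp add: P_def)
  qed simp
  from this[of "Suc d"] show ?thesis
    using assms by (simp flip: lessThan_Suc_atMost)
qed

text \<open>A discontinuous sign that flips at antipodes, used to label points where a function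
  vanishes.\<close>

definition first_positive :: "(nat \<Rightarrow> real) \<Rightarrow> bit" where
  "first_positive v = of_bool (\<exists>n. v n > 0 \<and> (\<forall>m<n. v m = 0))"

lemma first_positive_uminus:
  assumes "\<exists>n. v n \<noteq> 0"
  shows "first_positive (\<lambda>n. - v n) = first_positive v + 1"
proof -
  obtain n where n: "v n \<noteq> 0" "\<And>m. m < n \<Longrightarrow> v m = 0"
    using exists_least_iff[of "\<lambda>n. v n \<noteq> 0"] assms by blast
  have *: "(\<exists>n. w n > 0 \<and> (\<forall>m<n. w m = 0)) \<longleftrightarrow> w n > 0"
    if "w n \<noteq> 0" "\<And>m. m < n \<Longrightarrow> w m = 0" for w :: "nat \<Rightarrow> real"
    using that by (metis less_irrefl linorder_neqE_nat)
  have "first_positive v = of_bool (v n > 0)" "first_positive (\<lambda>n. - v n) = of_bool (- v n > 0)"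
    unfolding first_positive_def using *[of v] *[of "\<lambda>n. - v n"] n by auto
  then show ?thesis
    using n(1) by (cases "v n > 0") auto
qed

section \<open>Tychonoff's theorem and coordinatewise limits on function types\<close>

lemma compact_Pi_UNIV:
  assumes "\<And>i. compact (S i)"
  shows "compact (Pi UNIV S)"
proof -
  have "compactin (product_topology (\<lambda>_. euclidean) UNIV) (PiE UNIV S)"
    using assms by (simp add: compactin_PiE)
  then show ?thesis
    by (simp add: euclidean_product_topology PiE_UNIV_domain)
qed

lemma tendsto_fun:
  assumes "\<And>i. ((\<lambda>x. f x i) \<longlongrightarrow> l i) F"
  shows "(f \<longlongrightarrow> l) F"
proof -
  have "limitin (product_topology (\<lambda>_. euclidean) UNIV) f l F"
    using assms by (simp add: limitin_componentwise)
  then show ?thesis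
    by (simp add: euclidean_product_topology)
qed

text \<open>For the parities \<open>J r\<close>, the product of the classes of the functions in the cohomology of a
  product of projective spaces is \<open>\<Prod>r. \<Sum>b\<in>J r. t b\<close>. Its coefficient at the top
  monomial is \<open>1\<close>, as the leading terms multiply to that monomial.\<close>

lemma multi_odd_common_zero_nat:
  fixes F :: "nat \<Rightarrow> (nat \<Rightarrow> nat \<Rightarrow> real) \<Rightarrow> real" and J :: "nat \<Rightarrow> nat set"
  assumes cont: "\<And>r. r < N \<Longrightarrow> continuous_on UNIV (F r)"
    and J: "\<And>r. r < N \<Longrightarrow> J r \<noteq> {} \<and> J r \<subseteq> {..<k}"
    and odd: "\<And>r u b. r < N \<Longrightarrow> b < k \<Longrightarrow>
      F r (u(b := \<lambda>n. - u b n)) = (if b \<in> J r then - F r u else F r u)"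
  defines "d \<equiv> \<lambda>b. card {r. r < N \<and> Max (J r) = b}"
  obtains u where "\<And>b. b < k \<Longrightarrow> (\<Sum>n\<le>d b. (u b n)\<^sup>2) = 1"
    and "\<And>b n. b < k \<Longrightarrow> d b < n \<Longrightarrow> u b n = 0"
    and "\<And>r. r < N \<Longrightarrow> F r u = 0"
proof -
  define V where "V \<theta> b = spherical (\<lambda>j. \<theta> (b, j))" for \<theta> :: "nat \<times> nat \<Rightarrow> real" and b
  \<comment> \<open>The range \<open>{0..2 * Suc m}\<close> stands for \<open>{0..pi}\<close>;
    \<open>Suc\<close> avoids division by 0.\<close>
  define ang where "ang m x = (\<lambda>i. pi * real_of_int (x i) / (2 * real (Suc m)))"
    for m and x :: "nat \<times> nat \<Rightarrow> int"
  \<comment> \<open>At zeros of \<open>F r\<close> too the label must flip exactly for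
    \<open>b \<in> J r\<close>; adding one sign per block of \<open>J r\<close> achieves
    this.\<close>
  define lab where "lab r u = (if F r u > 0 then 1 else if F r u < 0 then 0
    else \<Sum>b\<in>J r. first_positive (u b))" for r u
  have finJ: "finite (J r)" if "r < N" for r
    using J[OF that] finite_subset by blast
  have lab_uminus: "lab r (u(b := \<lambda>n. - u b n)) = lab r u + of_bool (b \<in> J r)"
    if "r < N" "b < k" "\<exists>n. u b n \<noteq> 0" for r u b
  proof (cases "b \<in> J r")
    case True
    have "(\<Sum>b'\<in>J r. first_positive ((u(b := \<lambda>n. - u b n)) b'))
        = first_positive (u b) + 1 + (\<Sum>b'\<in>J r - {b}. first_positive (u b'))"
      using True that by (simp add: sum.remove[OF finJ] first_positive_uminus)
    also have "\<dots> = (\<Sum>b'\<in>J r. first_positive (u b')) + 1"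
      using True that by (simp add: sum.remove[OF finJ] ac_simps)
    finally show ?thesis
      using True odd[OF that(1,2), of u] by (auto simp: lab_def)
  next
    case False
    then have "(\<Sum>b'\<in>J r. first_positive ((u(b := \<lambda>n. - u b n)) b'))
        = (\<Sum>b'\<in>J r. first_positive (u b'))"
      by (intro sum.cong) auto
    then show ?thesis
      using False odd[OF that(1,2), of u] by (auto simp: lab_def)
  qed
  have "\<exists>x. (\<forall>i. 0 \<le> x i \<and> x i \<le> 2 * int (Suc m)) \<and> (\<forall>b<k. \<forall>j\<ge>d b. x (b, j) = 0)
      \<and> (\<forall>r<N. \<exists>y z. face_of_cell y x \<and> face_of_cell z x
        \<and> lab r (V (ang m y)) = 0 \<and> lab r (V (ang m z)) = 1)" for m
  proof -
    interpret antipodal_labelling "\<lambda>r x. lab r (V (ang m x))" J k N "Suc m"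
    proof
      fix r b i j v and x :: "nat \<times> nat \<Rightarrow> int"
      assume *: "r < N" "i < j" "x (b, i) \<in> {0, 2 * int (Suc m)}"
      have "ang m x (b, i) \<in> {0, pi}"
        using * by (auto simp: ang_def)
      then have sin: "sin (ang m x (b, i)) = 0"
        by auto
      define w where "w = pi * real_of_int v / (2 * real (Suc m))"
      have "V (ang m (x((b, j) := v))) b' = V (ang m x) b'" for b'
      proof (cases "b' = b")
        case True
        have "(\<lambda>j'. ang m (x((b, j) := v)) (b, j')) = (\<lambda>j'. ang m x (b, j'))(j := w)"
          by (auto simp: ang_def w_def)
        then show ?thesis
          unfolding True V_def using spherical_fun_upd[of "\<lambda>j'. ang m x (b, j')" i j w] sin *
          by simp
      next
        case False
        then show ?thesis
          by (simp add: V_def ang_def)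
      qed
      then show "lab r (V (ang m (x((b, j) := v)))) = lab r (V (ang m x))"
        by presburger
    next
      fix r b i and x :: "nat \<times> nat \<Rightarrow> int"
      assume *: "r < N" "b < k" and zero: "\<And>j. i \<le> j \<Longrightarrow> x (b, j) = 0"
      define x' where "x' = reflect ({b} \<times> {..i}) (2 * int (Suc m)) x"
      have ang0: "ang m x (b, i) = 0"
        by (simp add: ang_def zero)
      have "ang m x' (b, j) = (if j \<le> i then pi - ang m x (b, j) else ang m x (b, j))" for j
        by (simp add: ang_def x'_def reflect_def right_diff_distrib diff_divide_distrib del: of_nat_Suc)
      moreover have "ang m x' (b', j) = ang m x (b', j)" if "b' \<noteq> b" for b' j
        using that by (auto simp: ang_def x'_def reflect_def)
      ultimately have "V (ang m x') = (V (ang m x))(b := \<lambda>n. - V (ang m x) b n)"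
        using spherical_antipode[of "\<lambda>j. ang m x (b, j)" i] ang0 by (auto simp: V_def fun_eq_iff)
      moreover have "\<exists>n. V (ang m x) b n \<noteq> 0"
        using sum_spherical_squares[of "\<lambda>j. ang m x (b, j)" i] ang0 unfolding V_def
        by (metis (no_types, lifting) power_zero_numeral sum.neutral zero_neq_one)
      ultimately show "lab r (V (ang m x')) = lab r (V (ang m x)) + of_bool (b \<in> J r)"
        using lab_uminus * by simp
    qed (use J in blast)
    from ex_cell_all_labels_change obtain x where x: "x \<in> hemi_cells (leader_count N)"
      "\<forall>r<N. \<exists>y z. face_of_cell y x \<and> face_of_cell z x
        \<and> lab r (V (ang m y)) = 0 \<and> lab r (V (ang m z)) = 1"
      by blast
    have "leader_count N = d"
      by (auto simp: leader_count_def leader_def d_def)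
    then have "0 \<le> x (b, j) \<and> x (b, j) \<le> 2 * int (Suc m)"
        "b < k \<Longrightarrow> d b \<le> j \<Longrightarrow> x (b, j) = 0" for b j
      using x(1) by (cases "b < k \<and> j < d b"; force simp: hemi_cells_def box_cells_def)+
    then show ?thesis
      using x(2) by (intro exI[of _ x]) auto
  qed
  then obtain x where x: "\<And>m i. 0 \<le> x m i \<and> x m i \<le> 2 * int (Suc m)"
      "\<And>m b j. b < k \<Longrightarrow> d b \<le> j \<Longrightarrow> x m (b, j) = 0"
      "\<And>m r. r < N \<Longrightarrow> \<exists>y z. face_of_cell y (x m) \<and> face_of_cell z (x m)
        \<and> lab r (V (ang m y)) = 0 \<and> lab r (V (ang m z)) = 1"
    by metis
  have "real_of_int (x m i) \<le> 2 * real (Suc m)" for m i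
    using x(1)[of m i] by linarith
  then have "ang m (x m) \<in> Pi UNIV (\<lambda>_. {0..pi})" for m
    using x(1)[of m] by (auto simp: ang_def divide_simps)
  moreover have "compact (Pi UNIV (\<lambda>_. {0..pi}) :: (nat \<times> nat \<Rightarrow> real) set)"
    by (intro compact_Pi_UNIV) auto
  \<comment> \<open>The centres of the cells found for ever finer meshes have a limit point.\<close>
  ultimately obtain \<theta> s where s: "strict_mono (s :: nat \<Rightarrow> nat)"
      and lim: "((\<lambda>m. ang m (x m)) \<circ> s) \<longlonglongrightarrow> \<theta>"
    unfolding compact_eq_seq_compact_metric seq_compact_def by metis
  have lim_i: "(\<lambda>m. ang (s m) (x (s m)) i) \<longlonglongrightarrow> \<theta> i" for i
  proof -
    have "isCont (\<lambda>\<theta>. \<theta> i) \<theta>"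
      by (metis UNIV_I continuous_on_eq_continuous_at continuous_on_product_coordinates open_UNIV)
    from isCont_tendsto_compose[OF this lim] show ?thesis
      by (simp add: o_def)
  qed
  have zero: "\<theta> (b, j) = 0" if "b < k" "d b \<le> j" for b j
    using lim_i[of "(b, j)"] x(2)[OF that] by (simp add: ang_def LIMSEQ_const_iff)
  \<comment> \<open>Centres of faces differ from the centre of the cell by at most half an interval
    in each coordinate, so they share its limit.\<close>
  have lim_face: "(\<lambda>m. ang (s m) (y m)) \<longlonglongrightarrow> \<theta>" if y: "\<And>m. face_of_cell (y m) (x (s m))" for y
  proof (rule tendsto_fun)
    fix i
    have bound: "norm (ang (s m) (y m) i - ang (s m) (x (s m)) i) \<le> pi / (2 * real (Suc (s m)))" for m
    proof -
      have "\<bar>y m i - x (s m) i\<bar> \<le> 1"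
        using y[of m] unfolding face_of_cell_def by (metis abs_0 diff_self order_refl zero_le_one)
      then have "pi * \<bar>real_of_int (y m i) - real_of_int (x (s m) i)\<bar> \<le> pi * 1"
        by (intro mult_left_mono) (auto simp flip: of_int_diff of_int_abs)
      then show ?thesis
        by (simp add: ang_def abs_mult divide_right_mono flip: diff_divide_distrib right_diff_distrib)
    qed
    have "(\<lambda>m. pi / (2 * real (Suc (s m)))) \<longlonglongrightarrow> 0"
    proof -
      have "(\<lambda>m. pi / (2 * real (Suc m))) \<longlonglongrightarrow> 0"
        using tendsto_mult_right_zero[OF LIMSEQ_inverse_real_of_nat, of "pi / 2"]
        by (simp add: field_simps)
      from LIMSEQ_subseq_LIMSEQ[OF this s] show ?thesis
        by (simp add: o_def)
    qed
    then have "(\<lambda>m. ang (s m) (y m) i - ang (s m) (x (s m)) i) \<longlonglongrightarrow> 0"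
      by (rule Lim_null_comparison[OF always_eventually[OF allI[OF bound]]])
    from tendsto_add[OF this lim_i[of i]] show "(\<lambda>m. ang (s m) (y m) i) \<longlonglongrightarrow> \<theta> i"
      by simp
  qed
  have contV: "continuous_on UNIV V"
  proof (intro continuous_on_coordinatewise_then_product)
    show "continuous_on UNIV (\<lambda>\<theta>. V \<theta> b n)" for b n
      unfolding V_def spherical_def
      by (intro continuous_on_mult continuous_on_cos continuous_on_sin continuous_on_prod
          continuous_on_product_coordinates)
  qed
  have lim_F: "(\<lambda>m. F r (V (ang (s m) (y m)))) \<longlonglongrightarrow> F r (V \<theta>)"
    if "\<And>m. face_of_cell (y m) (x (s m))" "r < N" for y r
  proof -
    have "continuous_on UNIV (\<lambda>\<theta>. F r (V \<theta>))"
      using continuous_on_compose2[OF cont[OF \<open>r < N\<close>] contV] by simp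
    then show ?thesis
      using isCont_tendsto_compose[OF _ lim_face[OF that(1)], of "\<lambda>\<theta>. F r (V \<theta>)"]
      by (simp add: continuous_on_eq_continuous_at)
  qed
  show ?thesis
  proof (rule that)
    show "(\<Sum>n\<le>d b. (V \<theta> b n)\<^sup>2) = 1" if "b < k" for b
      unfolding V_def using zero that by (intro sum_spherical_squares) auto
    show "V \<theta> b n = 0" if "b < k" "d b < n" for b n
      unfolding V_def using zero that by (intro spherical_eq_0[of _ "d b"]) auto
    show "F r (V \<theta>) = 0" if r: "r < N" for r
    proof -
      obtain y z where yz: "\<And>m. face_of_cell (y m) (x m)" "\<And>m. face_of_cell (z m) (x m)"
        "\<And>m. lab r (V (ang m (y m))) = 0" "\<And>m. lab r (V (ang m (z m))) = 1"
        using x(3)[OF r] by metis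
      \<comment> \<open>Label 0 gives \<open>F r \<le> 0\<close>, label 1 gives
        \<open>F r \<ge> 0\<close>; both pass to the common limit.\<close>
      have "F r (V (ang (s m) (y (s m)))) \<le> 0" "F r (V (ang (s m) (z (s m)))) \<ge> 0" for m
        using yz(3,4)[of "s m"] by (auto simp: lab_def split: if_splits)
      then show ?thesis
        using lim_F[of "\<lambda>m. y (s m)" r] lim_F[of "\<lambda>m. z (s m)" r] yz(1,2) r
        by (intro antisym) (auto intro: LIMSEQ_le_const2 LIMSEQ_le_const)
    qed
  qed
qed

theorem multi_odd_common_zero:
  fixes F :: "'r \<Rightarrow> (nat \<Rightarrow> nat \<Rightarrow> real) \<Rightarrow> real" and J :: "'r \<Rightarrow> nat set"
  assumes "finite R"
    and cont: "\<And>r. r \<in> R \<Longrightarrow> continuous_on UNIV (F r)"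
    and J: "\<And>r. r \<in> R \<Longrightarrow> J r \<noteq> {} \<and> J r \<subseteq> {..<k}"
    and odd: "\<And>r u b. r \<in> R \<Longrightarrow> b < k \<Longrightarrow>
      F r (u(b := \<lambda>n. - u b n)) = (if b \<in> J r then - F r u else F r u)"
  defines "d \<equiv> \<lambda>b. card {r\<in>R. Max (J r) = b}"
  obtains u where "\<And>b. b < k \<Longrightarrow> (\<Sum>n\<le>d b. (u b n)\<^sup>2) = 1"
    and "\<And>b n. b < k \<Longrightarrow> d b < n \<Longrightarrow> u b n = 0"
    and "\<And>r. r \<in> R \<Longrightarrow> F r u = 0"
proof -
  obtain h and N :: nat where h: "bij_betw h {..<N} R"
    using ex_bij_betw_nat_finite[OF \<open>finite R\<close>] by (metis atLeast0LessThan)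
  then have R: "R = h ` {..<N}" and inj: "inj_on h {..<N}"
    by (auto simp: bij_betw_def)
  have d: "card {r. r < N \<and> Max (J (h r)) = b} = d b" for b
  proof -
    have "{r\<in>R. Max (J r) = b} = h ` {r. r < N \<and> Max (J (h r)) = b}"
      unfolding R by auto
    then show ?thesis
      unfolding d_def by (metis (no_types, lifting) card_image inj inj_on_subset lessThan_iff mem_Collect_eq subsetI)
  qed
  obtain u where u: "\<And>b. b < k \<Longrightarrow> (\<Sum>n\<le>d b. (u b n)\<^sup>2) = 1"
      "\<And>b n. b < k \<Longrightarrow> d b < n \<Longrightarrow> u b n = 0" "\<And>r. r < N \<Longrightarrow> F (h r) u = 0"
  proof (rule multi_odd_common_zero_nat[of N "\<lambda>r. F (h r)" "\<lambda>r. J (h r)" k, unfolded d])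
    have "h r \<in> R" if "r < N" for r
      using that R by blast
    then show "continuous_on UNIV (F (h r))" "J (h r) \<noteq> {} \<and> J (h r) \<subseteq> {..<k}"
      "b < k \<Longrightarrow> F (h r) (v(b := \<lambda>n. - v b n)) = (if b \<in> J (h r) then - F (h r) v else F (h r) v)"
      if "r < N" for r b v
      using that cont J odd by blast+
  qed blast
  moreover have "F r u = 0" if "r \<in> R" for r
    using u(3) that R by blast
  ultimately show ?thesis
    using that by blast
qed

section \<open>Planes avoiding compact sets\<close>

text \<open>A continuous image of weights times points. Both are compact sets of infinite sequences,
  of which only the first \<open>m\<close> entries enter the sum.\<close>

lemma compact_conv_m:
  fixes X :: "'a::real_normed_vector set"
  assumes "compact X"
  shows "compact (conv_m m X)"
proof (cases "X = {}")
  case True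
  have "conv_m m X = {}"
    unfolding conv_m_def True by (force simp: less_eq_Suc_le)
  then show ?thesis by simp
next
  case False
  then obtain x0 where "x0 \<in> X" by blast
  define U where "U = {u \<in> Pi UNIV (\<lambda>_. {0..1}). (\<Sum>i<m. u i) = (1::real)}"
  have cont_sum: "continuous_on UNIV (\<lambda>u. \<Sum>i<m. u i :: real)"
    by (intro continuous_intros continuous_on_product_coordinates)
  have "closed {u. (\<Sum>i<m. u i) = (1::real)}"
    using continuous_closed_preimage_constant[OF cont_sum, of 1] by simp
  then have "compact (Pi UNIV (\<lambda>_. {0..1}) \<inter> {u. (\<Sum>i<m. u i) = (1::real)})"
    by (intro compact_Int_closed compact_Pi_UNIV) auto
  then have "compact U"
    by (simp add: U_def Int_def)
  moreover have "compact (Pi UNIV (\<lambda>_::nat. X))"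
    by (intro compact_Pi_UNIV assms)
  moreover have "continuous_on S (\<lambda>(u, x). \<Sum>i<m. u i *\<^sub>R x i)"
    for S :: "((nat \<Rightarrow> real) \<times> (nat \<Rightarrow> 'a)) set"
    unfolding case_prod_unfold
    by (intro continuous_on_sum continuous_on_scaleR continuous_on_fst continuous_on_snd
        continuous_on_id continuous_on_product_then_coordinatewise[of S fst]
        continuous_on_product_then_coordinatewise[of S snd])
  ultimately have "compact ((\<lambda>(u, x). \<Sum>i<m. u i *\<^sub>R x i) ` (U \<times> Pi UNIV (\<lambda>_. X)))"
    by (intro compact_continuous_image compact_Times)
  also have "(\<lambda>(u, x). \<Sum>i<m. u i *\<^sub>R x i) ` (U \<times> Pi UNIV (\<lambda>_. X)) = conv_m m X"
  proof safe
    fix u and x :: "nat \<Rightarrow> 'a" assume *: "u \<in> U" "x \<in> UNIV \<rightarrow> X"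
    then have "m \<noteq> 0"
      by (metis (mono_tags, lifting) U_def lessThan_0 mem_Collect_eq sum.empty zero_neq_one)
    then show "(\<Sum>i<m. u i *\<^sub>R x i) \<in> conv_m m X"
      unfolding conv_m_def using *
      by (auto simp: U_def Pi_iff intro!: exI[of _ m] exI[of _ u] exI[of _ x])
  next
    fix y assume "y \<in> conv_m m X"
    then obtain j u x where j: "j \<le> m" and u: "\<And>i. i < j \<Longrightarrow> 0 \<le> u i \<and> x i \<in> X"
      "(\<Sum>i<j. u i) = 1" and y: "y = (\<Sum>i<j. u i *\<^sub>R x i)"
      unfolding conv_m_def by blast
    \<comment> \<open>Fewer than \<open>m\<close> points are padded by \<open>x0\<close> with weight
      0.\<close>
    define u' where "u' i = (if i < j then u i else 0)" for i
    define x' where "x' i = (if i < j then x i else x0)" for i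
    have "u i \<le> 1" if "i < j" for i
      using member_le_sum[of i "{..<j}" u] u that by auto
    moreover have "(\<Sum>i<m. u' i) = (\<Sum>i<j. u i)"
      using j by (intro sum.mono_neutral_cong_right) (auto simp: u'_def)
    ultimately have "u' \<in> U"
      using u by (auto simp: U_def u'_def)
    moreover have "x' \<in> Pi UNIV (\<lambda>_. X)"
      using u \<open>x0 \<in> X\<close> by (auto simp: x'_def)
    moreover have "(\<Sum>i<m. u' i *\<^sub>R x' i) = y"
      unfolding y using j by (intro sum.mono_neutral_cong_right) (auto simp: u'_def x'_def)
    ultimately show "y \<in> (\<lambda>(u, x). \<Sum>i<m. u i *\<^sub>R x i) ` (U \<times> Pi UNIV (\<lambda>_. X))"
      by force
  qed
  finally show ?thesis .
qed

lemma sum_in_conv_m: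
  assumes "finite S" "card S \<le> m" "\<And>v. v \<in> S \<Longrightarrow> 0 \<le> u v" "sum u S = 1" "g ` S \<subseteq> X"
  shows "(\<Sum>v\<in>S. u v *\<^sub>R g v) \<in> conv_m m X"
proof -
  obtain h where h: "bij_betw h {..<card S} S"
    using ex_bij_betw_nat_finite[OF \<open>finite S\<close>] by (auto simp: atLeast0LessThan)
  then have "(\<Sum>i<card S. u (h i)) = 1" "(\<Sum>i<card S. u (h i) *\<^sub>R g (h i)) = (\<Sum>v\<in>S. u v *\<^sub>R g v)"
    using assms(4) sum.reindex_bij_betw[OF h, of u]
      sum.reindex_bij_betw[OF h, of "\<lambda>v. u v *\<^sub>R g v"] by simp_all
  moreover have "card S \<ge> 1"
    using assms by (metis One_nat_def Suc_leI card_gt_0_iff sum.empty zero_neq_one)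
  moreover have "h i \<in> S" if "i < card S" for i
    using h that by (auto simp: bij_betw_def)
  ultimately show ?thesis
    unfolding conv_m_def using assms
    by (auto intro!: exI[of _ "card S"] exI[of _ "\<lambda>i. u (h i)"] exI[of _ "\<lambda>i. g (h i)"])
qed

text \<open>The orthogonal projection onto the span of an orthonormal frame. For any frame it is
  continuous in the frame and even in each vector, so it can be used before orthonormality is
  known.\<close>

definition proj_on :: "(nat \<Rightarrow> 'a::euclidean_space) \<Rightarrow> nat \<Rightarrow> 'a \<Rightarrow> 'a" where
  "proj_on f k w = (\<Sum>j<k. (w \<bullet> f j) *\<^sub>R f j)"

lemma linear_proj_on: "linear (proj_on f k)"
  by (rule linearI)
    (simp_all add: proj_on_def inner_add_left scaleR_add_left sum.distrib scaleR_sum_right)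

lemma proj_on_in_span: "proj_on f k w \<in> span (f ` {..<k})"
  unfolding proj_on_def by (intro span_sum span_scale span_base) auto

text \<open>The projection fixes the span, so \<open>w\<close> and \<open>w - v\<close> have the
  same residual, which by Pythagoras is no longer than \<open>w - v\<close>.\<close>

lemma
  fixes f :: "nat \<Rightarrow> 'a::euclidean_space"
  assumes orth: "\<And>i j. i < k \<Longrightarrow> j < k \<Longrightarrow> f i \<bullet> f j = (if i = j then 1 else 0)"
  shows norm_diff_proj_on: "v \<in> span (f ` {..<k}) \<Longrightarrow> norm (w - proj_on f k w) \<le> norm (w - v)"
    and dim_span_orthonormal: "dim (span (f ` {..<k})) = k"
proof -
  have inner: "proj_on f k w \<bullet> f i = w \<bullet> f i" if "i < k" for w i
  proof -
    have "proj_on f k w \<bullet> f i = (\<Sum>j<k. if j = i then w \<bullet> f j else 0)"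
      unfolding proj_on_def inner_sum_left using that by (intro sum.cong) (auto simp: orth)
    then show ?thesis
      using that by simp
  qed
  have fix_f: "proj_on f k (f i) = f i" if "i < k" for i
  proof -
    have "proj_on f k (f i) = (\<Sum>j<k. if j = i then f j else 0)"
      unfolding proj_on_def using that by (intro sum.cong) (auto simp: orth)
    then show ?thesis
      using that by simp
  qed
  have fix_span: "proj_on f k v = v" if "v \<in> span (f ` {..<k})" for v
  proof -
    have "proj_on f k v = id v"
      by (rule linear_eq_on_span[OF linear_proj_on linear_id _ that]) (auto simp: fix_f)
    then show ?thesis
      by simp
  qed
  have shrink: "norm (g - proj_on f k g) \<le> norm g" for g
  proof -
    have "(g - proj_on f k g) \<bullet> proj_on f k w = 0" for w
      unfolding proj_on_def[of f k w] by (simp add: inner_sum_right inner_diff_left inner)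
    then have "(norm g)\<^sup>2 = (norm (g - proj_on f k g))\<^sup>2 + (norm (proj_on f k g))\<^sup>2"
      using norm_add_Pythagorean[of "g - proj_on f k g" "proj_on f k g"]
      by (simp add: orthogonal_def)
    then have "(norm (g - proj_on f k g))\<^sup>2 \<le> (norm g)\<^sup>2"
      by simp
    then show ?thesis
      by (rule power2_le_imp_le) simp
  qed
  show "norm (w - proj_on f k w) \<le> norm (w - v)" if "v \<in> span (f ` {..<k})"
    using shrink[of "w - v"] fix_span[OF that] by (simp add: linear_diff[OF linear_proj_on])
  have "inj_on f {..<k}"
    by (intro inj_onI) (metis lessThan_iff orth zero_neq_one)
  moreover have "independent (f ` {..<k})"
  proof (rule pairwise_orthogonal_independent)
    show "pairwise orthogonal (f ` {..<k})"
      by (auto simp: pairwise_def orthogonal_def orth)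
    show "0 \<notin> f ` {..<k}"
      using orth by (metis imageE inner_zero_left lessThan_iff zero_neq_one)
  qed
  ultimately show "dim (span (f ` {..<k})) = k"
    by (simp add: dim_span dim_eq_card_independent card_image)
qed

text \<open>If the plane met \<open>X\<close>, some weight would be positive, and \<open>0\<close> would be a convex
  combination of projections of points of \<open>X - p\<close> close to the plane. By Caratheodory's
  theorem in the plane, \<open>k + 1\<close> points suffice.\<close>

lemma plane_avoids:
  fixes f :: "nat \<Rightarrow> 'a::euclidean_space"
  assumes orth: "\<And>i j. i < k \<Longrightarrow> j < k \<Longrightarrow> f i \<bullet> f j = (if i = j then 1 else 0)"
    and Y: "finite Y" "Y \<subseteq> X" "X \<subseteq> (\<Union>y\<in>Y. ball y \<epsilon>)"
    and far: "\<And>c. c \<in> conv_m (k + 1) X \<Longrightarrow> \<epsilon> \<le> dist p c"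
    and zero: "\<And>j. j < k \<Longrightarrow>
      (\<Sum>x\<in>Y. max 0 (\<epsilon> - norm ((x - p) - proj_on f k (x - p))) * ((x - p) \<bullet> f j)) = 0"
  shows "(+) p ` span (f ` {..<k}) \<inter> X = {}"
proof (rule ccontr)
  assume "\<not> ?thesis"
  then obtain v where v: "v \<in> span (f ` {..<k})" "p + v \<in> X"
    by blast
  define P where "P = proj_on f k"
  define wt where "wt x = max 0 (\<epsilon> - norm ((x - p) - P (x - p)))" for x
  define W where "W = {x \<in> Y. wt x > 0}"
  have "finite W" "W \<subseteq> Y"
    using Y by (auto simp: W_def)
  have near: "norm ((x - p) - P (x - p)) < \<epsilon>" if "x \<in> W" for x
    using that by (auto simp: W_def wt_def)
  obtain y where y: "y \<in> Y" "dist y (p + v) < \<epsilon>"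
    using Y v by auto
  have "norm ((y - p) - P (y - p)) \<le> norm ((y - p) - v)"
    unfolding P_def by (rule norm_diff_proj_on[OF orth v(1)])
  then have "y \<in> W"
    using y by (simp add: W_def wt_def dist_norm algebra_simps)
  then have pos: "sum wt W > 0"
    using \<open>finite W\<close> by (intro sum_pos) (auto simp: W_def)
  define T where "T = (\<lambda>x. P (x - p)) ` W"
  \<comment> \<open>The coefficients of this sum in the frame are the expressions in
    \<open>zero\<close>.\<close>
  have sum0: "(\<Sum>x\<in>W. wt x *\<^sub>R P (x - p)) = 0"
  proof -
    have "(\<Sum>x\<in>W. wt x *\<^sub>R P (x - p)) = (\<Sum>x\<in>Y. wt x *\<^sub>R P (x - p))"
      using Y(1) by (intro sum.mono_neutral_left) (auto simp: W_def wt_def)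
    also have "\<dots> = (\<Sum>j<k. (\<Sum>x\<in>Y. wt x * ((x - p) \<bullet> f j)) *\<^sub>R f j)"
      unfolding P_def proj_on_def scaleR_sum_right scaleR_sum_left scaleR_scaleR
      by (rule sum.swap)
    also have "\<dots> = 0"
      using zero by (intro sum.neutral) (auto simp: wt_def P_def)
    finally show ?thesis .
  qed
  have "(\<Sum>x\<in>W. (wt x / sum wt W) *\<^sub>R P (x - p)) \<in> convex hull T"
    using pos \<open>finite W\<close> by (intro convex_sum)
      (auto simp: T_def W_def sum_divide_distrib[symmetric] intro!: hull_inc)
  also have "(\<Sum>x\<in>W. (wt x / sum wt W) *\<^sub>R P (x - p))
      = (1 / sum wt W) *\<^sub>R (\<Sum>x\<in>W. wt x *\<^sub>R P (x - p))"
    by (simp add: scaleR_sum_right)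
  finally have "0 \<in> convex hull T"
    by (simp add: sum0)
  then obtain S where S: "finite S" "S \<subseteq> T" "card S \<le> aff_dim T + 1" "0 \<in> convex hull S"
    using caratheodory_aff_dim[of T] by blast
  have "T \<subseteq> span (f ` {..<k})"
    unfolding T_def P_def using proj_on_in_span by blast
  then have "aff_dim T \<le> int k"
    using aff_dim_subset aff_dim_subspace[OF subspace_span] dim_span_orthonormal[OF orth] by metis
  then have "card S \<le> k + 1"
    using S(3) by simp
  obtain u where u: "\<And>v. v \<in> S \<Longrightarrow> 0 \<le> u v" "sum u S = 1" "(\<Sum>v\<in>S. u v *\<^sub>R v) = 0"
    using S(1,4) by (auto simp: convex_hull_finite)
  have "\<forall>v\<in>S. \<exists>x. x \<in> W \<and> P (x - p) = v"
    using S(2) by (auto simp: T_def)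
  from bchoice[OF this] obtain g where g: "\<And>v. v \<in> S \<Longrightarrow> g v \<in> W \<and> P (g v - p) = v"
    by blast
  \<comment> \<open>The same weights on the unprojected points. As the projections average to 0,
    \<open>c - p\<close> is an average of residuals shorter than \<open>\<epsilon>\<close>.\<close>
  define c where "c = (\<Sum>v\<in>S. u v *\<^sub>R g v)"
  have "g ` S \<subseteq> X"
    using g \<open>W \<subseteq> Y\<close> Y(2) by blast
  then have "c \<in> conv_m (k + 1) X"
    unfolding c_def using S(1) \<open>card S \<le> k + 1\<close> u by (intro sum_in_conv_m) auto
  moreover have "(g v - p) - v \<in> ball 0 \<epsilon>" if "v \<in> S" for v
    using near[of "g v"] g[OF that] by simp
  then have "(\<Sum>v\<in>S. u v *\<^sub>R ((g v - p) - v)) \<in> ball 0 \<epsilon>"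
    by (intro convex_sum[OF S(1) convex_ball u(2)] u(1))
  moreover have "(\<Sum>v\<in>S. u v *\<^sub>R ((g v - p) - v)) = c - p"
    using u by (simp add: c_def scaleR_diff_right sum_subtractf flip: scaleR_sum_left)
  ultimately show False
    using far[of c] by (simp add: dist_norm norm_minus_commute)
qed

theorem theorem2p1:
  fixes X :: "nat \<Rightarrow> 'a::euclidean_space set" and p :: 'a and k :: nat
  assumes "k < DIM('a)"
    and "\<And>i. i \<in> {1..DIM('a) - k} \<Longrightarrow> compact (X i)"
    and "\<And>i. i \<in> {1..DIM('a) - k} \<Longrightarrow> p \<notin> conv_m (k + 1) (X i)"
  shows "\<exists>L. affine L \<and> aff_dim L = int k \<and> p \<in> L \<and>
           (\<forall>i \<in> {1..DIM('a) - k}. L \<inter> X i = {})"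
proof -
  define n where "n = DIM('a)"
  define m where "m = n - k"
  have "n = m + k"
    using assms(1) by (simp add: m_def n_def)
  have cpt: "compact (X i)" and notin: "p \<notin> conv_m (k + 1) (X i)" if "i \<in> {1..m}" for i
    using that assms(2,3) by (auto simp: m_def n_def)
  have "\<exists>\<delta>>0. \<forall>c\<in>conv_m (k + 1) (X i). \<delta> \<le> dist p c" if "i \<in> {1..m}" for i
    using separate_point_closed[OF compact_imp_closed[OF compact_conv_m[OF cpt]] notin] that by blast
  then obtain \<delta> where \<delta>: "\<And>i. i \<in> {1..m} \<Longrightarrow> \<delta> i > 0"
      "\<And>i c. i \<in> {1..m} \<Longrightarrow> c \<in> conv_m (k + 1) (X i) \<Longrightarrow> \<delta> i \<le> dist p c"
    by metis
  \<comment> \<open>A common margin for all sets, used both as radius of the nets and as cut-off of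
    the weights.\<close>
  define \<epsilon> where "\<epsilon> = Min (insert 1 (\<delta> ` {1..m}))"
  have "\<epsilon> > 0"
    unfolding \<epsilon>_def using \<delta>(1) by (subst Min_gr_iff) auto
  have far: "\<epsilon> \<le> dist p c" if "i \<in> {1..m}" "c \<in> conv_m (k + 1) (X i)" for i c
  proof -
    have "\<epsilon> \<le> \<delta> i"
      unfolding \<epsilon>_def using that by (intro Min_le) auto
    then show ?thesis
      using \<delta>(2)[OF that] by simp
  qed
  have "\<exists>Y. finite Y \<and> Y \<subseteq> X i \<and> X i \<subseteq> (\<Union>y\<in>Y. ball y \<epsilon>)" if "i \<in> {1..m}" for i
  proof -
    have "X i \<subseteq> (\<Union>y\<in>X i. ball y \<epsilon>)"
      using \<open>\<epsilon> > 0\<close> by auto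
    then show ?thesis
      by (rule compactE_image[OF cpt[OF that], rotated]) auto
  qed
  then obtain Y where Y: "\<And>i. i \<in> {1..m} \<Longrightarrow> finite (Y i)" "\<And>i. i \<in> {1..m} \<Longrightarrow> Y i \<subseteq> X i"
      "\<And>i. i \<in> {1..m} \<Longrightarrow> X i \<subseteq> (\<Union>y\<in>Y i. ball y \<epsilon>)"
    by metis
  obtain e where e: "bij_betw e {..<n} (Basis :: 'a set)"
    using ex_bij_betw_nat_finite[OF finite_Basis] by (auto simp: n_def atLeast0LessThan)
  define f where "f u b = (\<Sum>i<n. u b i *\<^sub>R e i)" for u :: "nat \<Rightarrow> nat \<Rightarrow> real" and b
  have inner_e: "e i \<bullet> e j = (if i = j then 1 else 0)" if "i < n" "j < n" for i j
  proof -
    have "e i \<in> Basis" "e j \<in> Basis"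
      using e that by (auto simp: bij_betw_def)
    moreover have "e i = e j \<longleftrightarrow> i = j"
      using e that by (auto simp: bij_betw_def inj_on_def)
    ultimately show ?thesis
      by (simp add: inner_Basis)
  qed
  have inner_f: "f u b \<bullet> f u b' = (\<Sum>i<n. u b i * u b' i)" for u b b'
    by (simp add: f_def inner_sum_left inner_sum_right inner_e if_distrib mult.commute
        cong: if_cong)
  have f_upd: "f (u(b := \<lambda>n. - u b n)) b' = (if b' = b then - f u b' else f u b')" for u b b'
    by (simp add: f_def sum_negf)
  \<comment> \<open>For \<open>s < m\<close> this is the component along \<open>f u j\<close> of the
    weighted sum for \<open>X (Suc s)\<close>, the sets being numbered from 1; otherwise it encodes
    orthogonality to vector \<open>s - m\<close>.\<close>
  define F where "F = (\<lambda>(j, s) u. if s < m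
    then \<Sum>x\<in>Y (Suc s). max 0 (\<epsilon> - norm ((x - p) - proj_on (f u) k (x - p))) * ((x - p) \<bullet> f u j)
    else f u (s - m) \<bullet> f u j)"
  \<comment> \<open>Vector \<open>j\<close> carries \<open>m\<close> components and \<open>j\<close>
    inner products with earlier vectors, so it ranges over a sphere of dimension
    \<open>m + j < n\<close>.\<close>
  define R where "R = (SIGMA j:{..<k}. {..<m + j})"
  define J where "J = (\<lambda>(j, s). if s < m then {j} else {j, s - m})"
  have cont_f: "continuous_on UNIV (\<lambda>u. f u b)" for b
    unfolding f_def
    by (intro continuous_on_sum continuous_on_scaleR continuous_on_const
        continuous_on_product_then_coordinatewise[of UNIV "\<lambda>u. u b"] continuous_on_product_coordinates)
  have count: "card {r\<in>R. Max (J r) = b} = m + b" if "b < k" for b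
  proof -
    have "Max (J r) = fst r" if "r \<in> R" for r
      using that by (auto simp: R_def J_def)
    then have "{r\<in>R. Max (J r) = b} = {b} \<times> {..<m + b}"
      using that by (auto simp: R_def)
    then show ?thesis
      by simp
  qed
  obtain u where u: "\<And>b. b < k \<Longrightarrow> (\<Sum>i\<le>m + b. (u b i)\<^sup>2) = 1"
      "\<And>b i. b < k \<Longrightarrow> m + b < i \<Longrightarrow> u b i = 0" "\<And>r. r \<in> R \<Longrightarrow> F r u = 0"
  proof (rule multi_odd_common_zero[of R F J k])
    show "finite R"
      by (simp add: R_def)
    show "continuous_on UNIV (F r)" for r
    proof (cases r)
      case (Pair j s)
      show ?thesis
        unfolding Pair F_def proj_on_def prod.case
        by (cases "s < m"; simp; intro continuous_intros cont_f)
    qed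
    show "J r \<noteq> {} \<and> J r \<subseteq> {..<k}" if "r \<in> R" for r
      using that by (auto simp: R_def J_def split: if_splits)
    show "F r (u(b := \<lambda>n. - u b n)) = (if b \<in> J r then - F r u else F r u)"
      if "r \<in> R" "b < k" for r u b
    proof -
      \<comment> \<open>Each summand contains its frame vector twice, so signs cancel.\<close>
      have "proj_on (f (u(b := \<lambda>n. - u b n))) k w = proj_on (f u) k w" for w
        unfolding proj_on_def by (intro sum.cong) (auto simp: f_upd)
      then show ?thesis
        using that by (auto simp: F_def J_def R_def f_upd sum_negf)
    qed
  qed (simp add: count, blast)
  have orth_less: "f u i \<bullet> f u j = 0" if "i < j" "j < k" for i j
    using u(3)[of "(j, m + i)"] that by (simp add: R_def F_def)
  have unit: "f u i \<bullet> f u i = 1" if "i < k" for i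
  proof -
    have "f u i \<bullet> f u i = (\<Sum>l<n. (u i l)\<^sup>2)"
      by (simp add: inner_f power2_eq_square)
    also have "\<dots> = (\<Sum>l\<le>m + i. (u i l)\<^sup>2)"
      using that u(2) \<open>n = m + k\<close> by (intro sum.mono_neutral_right) auto
    finally show ?thesis
      using u(1) that by simp
  qed
  have orth: "f u i \<bullet> f u j = (if i = j then 1 else 0)" if "i < k" "j < k" for i j
    using that orth_less[of i j] orth_less[of j i] unit
    by (cases i j rule: linorder_cases) (auto simp: inner_commute)
  define V where "V = span (f u ` {..<k})"
  have "(+) p ` V \<inter> X i = {}" if i: "i \<in> {1..m}" for i
    unfolding V_def
  proof (rule plane_avoids[OF orth Y[OF i] far[OF i]])
    fix j assume "j < k"
    moreover obtain s where "i = Suc s" "s < m"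
      using i by (cases i) auto
    ultimately show "(\<Sum>x\<in>Y i. max 0 (\<epsilon> - norm ((x - p) - proj_on (f u) k (x - p))) * ((x - p) \<bullet> f u j)) = 0"
      using u(3)[of "(j, s)"] by (simp add: R_def F_def)
  qed
  moreover have "affine ((+) p ` V)"
    by (simp add: V_def affine_translation[symmetric] subspace_imp_affine)
  moreover have "aff_dim ((+) p ` V) = int k"
    using dim_span_orthonormal[of k "f u", OF orth]
    by (simp add: V_def aff_dim_translation_eq aff_dim_subspace)
  moreover have "p \<in> (+) p ` V"
    using span_zero by (force simp: V_def)
  ultimately show ?thesis
    by (metis m_def n_def)
qed

end
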